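(* Let $p$ be a positive integer. (1) If $p$ is odd and $p\ge 5$, then $\mathrm{ex}(p+6,B_p)=(p+3)(p+5)/2$; (2) if $p$ is even and $p\notin\{2,6,10\}$, then $\mathrm{ex}(p+6,B_p)=1+(p+2)(p+6)/2$.
   Context: The book $B_p$ is the graph consisting of $p$ triangles sharing a common edge. For a graph $H$ and positive integer $n$, $\mathrm{ex}(n,H)$ is the maximum number of edges of a simple graph of order $n$ not containing $H$ as a subgraph. *)

theory Defs
  imports Complex_Main
begin

(* A graph is a pair of its vertex set and its edge set; an edge is the set of its two ends. *)
type_synonym 'a sgraph = "'a set \<times> 'a set set"

abbreviation verts :: "'a sgraph \<Rightarrow> 'a set" where
  "verts \<equiv> fst"

abbreviation edges :: "'a sgraph \<Rightarrow> 'a set set" where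
  "edges \<equiv> snd"

definition simple_graph :: "'a sgraph \<Rightarrow> bool" where
  "simple_graph G \<longleftrightarrow> finite (verts G) \<and> (\<forall>e\<in>edges G. e \<subseteq> verts G \<and> card e = 2)"

(* G has a (not necessarily induced) subgraph isomorphic to H. *)
definition contains_subgraph :: "'a sgraph \<Rightarrow> 'b sgraph \<Rightarrow> bool" where
  "contains_subgraph G H \<longleftrightarrow>
     (\<exists>f. inj_on f (verts H) \<and> f ` verts H \<subseteq> verts G \<and> (\<forall>e\<in>edges H. f ` e \<in> edges G))"

(* The vertices are taken from nat, which hosts a copy of every finite graph. For every graph H
   with at least one edge the set is nonempty, and it is always finite, so Max is a true maximum. *)
definition ex :: "nat \<Rightarrow> 'b sgraph \<Rightarrow> nat" where
  "ex n H = Max {card (edges G) | G :: nat sgraph.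
     simple_graph G \<and> card (verts G) = n \<and> \<not> contains_subgraph G H}"

(* The common edge is {0, 1}; the third vertices of the p triangles are 2, ..., p + 1. *)
definition book :: "nat \<Rightarrow> nat sgraph" where
  "book p = ({..<p + 2}, insert {0, 1} (\<Union>i\<in>{2..<p + 2}. {{0, i}, {1, i}}))"

end

theory Submission
  imports Defs
begin

text \<open>
  A graph of order \<open>p + 6\<close> is \<open>B\<^sub>p\<close>-free iff in its complement the neighbourhoods of any
  two distinct nonadjacent vertices have at least five vertices in their union. Hence the vertices
  of complement degree at most 2 are pairwise adjacent in the complement, so there are at most
  three of them, and the complement has degree sum at least \<open>3 (n - 1)\<close> for \<open>n = p + 6\<close>; parity
  improves this by one when \<open>n\<close> is even. Disjoint unions of a triangle, copies of \<open>K\<^sub>4\<close>, possibly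
  a Petersen graph, and, for even \<open>n\<close>, a graph on seven vertices with degrees \<open>4, 3, \<dots>, 3\<close>
  attain the bound.
\<close>

section \<open>Degrees in a graph and in its complement\<close>

definition nbrs :: "'a sgraph \<Rightarrow> 'a \<Rightarrow> 'a set" where
  "nbrs G v = {u \<in> verts G. {u, v} \<in> edges G}"

text \<open>This is the neighbourhood of \<open>v\<close> in the complement graph, which is itself
  never constructed for a given \<open>G\<close>.\<close>

definition conbrs :: "'a sgraph \<Rightarrow> 'a \<Rightarrow> 'a set" where
  "conbrs G v = {u \<in> verts G. u \<noteq> v \<and> {u, v} \<notin> edges G}"

lemma simple_graph_finite_verts: "simple_graph G \<Longrightarrow> finite (verts G)"
  by (simp add: simple_graph_def)

lemma simple_graph_no_loop: "simple_graph G \<Longrightarrow> {v} \<notin> edges G"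
  unfolding simple_graph_def by force

lemma simple_graph_edge_verts:
  assumes "simple_graph G" "{u, v} \<in> edges G"
  shows "u \<in> verts G" "v \<in> verts G" "u \<noteq> v"
  using assms simple_graph_no_loop[of G v] unfolding simple_graph_def by auto

lemma finite_nbrs: "simple_graph G \<Longrightarrow> finite (nbrs G v)"
  by (simp add: nbrs_def simple_graph_finite_verts)

lemma finite_conbrs: "simple_graph G \<Longrightarrow> finite (conbrs G v)"
  by (simp add: conbrs_def simple_graph_finite_verts)

lemma finite_edges:
  assumes "simple_graph G"
  shows "finite (edges G)"
proof (rule finite_subset)
  show "edges G \<subseteq> Pow (verts G)" using assms by (auto simp: simple_graph_def)
qed (use assms in \<open>simp add: simple_graph_finite_verts\<close>)

lemma card_nbrs_eq_incident:
  assumes "simple_graph G"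
  shows "card (nbrs G v) = card {e \<in> edges G. v \<in> e}"
proof (rule bij_betw_same_card)
  show "bij_betw (\<lambda>u. {u, v}) (nbrs G v) {e \<in> edges G. v \<in> e}"
    unfolding bij_betw_def
  proof (intro conjI equalityI subsetI)
    show "inj_on (\<lambda>u. {u, v}) (nbrs G v)"
      by (auto simp: inj_on_def doubleton_eq_iff)
  next
    fix e assume e: "e \<in> {e \<in> edges G. v \<in> e}"
    then have "card e = 2" "e \<subseteq> verts G" using assms by (auto simp: simple_graph_def)
    then obtain a b where "e = {a, b}" by (meson card_2_iff)
    with e \<open>e \<subseteq> verts G\<close> show "e \<in> (\<lambda>u. {u, v}) ` nbrs G v"
      by (auto simp: nbrs_def insert_commute)
  qed (auto simp: nbrs_def)
qed

lemma sum_card_nbrs: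
  assumes "simple_graph G"
  shows "(\<Sum>v\<in>verts G. card (nbrs G v)) = 2 * card (edges G)"
proof -
  have "(\<Sum>v\<in>verts G. card {e \<in> edges G. v \<in> e}) = 2 * card (edges G)"
  proof (rule sum_multicount)
    show "\<forall>e\<in>edges G. card {v \<in> verts G. v \<in> e} = 2"
    proof
      fix e assume "e \<in> edges G"
      then have "e \<subseteq> verts G" "card e = 2" using assms by (auto simp: simple_graph_def)
      moreover have "{v \<in> verts G. v \<in> e} = e" using \<open>e \<subseteq> verts G\<close> by auto
      ultimately show "card {v \<in> verts G. v \<in> e} = 2" by simp
    qed
  qed (use assms in \<open>simp_all add: simple_graph_finite_verts finite_edges\<close>)
  then show ?thesis by (simp add: card_nbrs_eq_incident assms)
qed

lemma card_nbrs_conbrs: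
  assumes "simple_graph G" "v \<in> verts G"
  shows "card (nbrs G v) + card (conbrs G v) = card (verts G) - 1"
proof -
  have "nbrs G v \<union> conbrs G v = verts G - {v}"
    using simple_graph_no_loop[OF assms(1), of v] by (auto simp: nbrs_def conbrs_def)
  moreover have "nbrs G v \<inter> conbrs G v = {}"
    by (auto simp: nbrs_def conbrs_def)
  ultimately show ?thesis
    using card_Un_disjoint[of "nbrs G v" "conbrs G v"] assms
    by (simp add: finite_nbrs finite_conbrs)
qed

text \<open>Degree and complement degree add up to \<open>card (verts G) - 1\<close> at each vertex,
  so a lower bound on the complement degree sum becomes an upper bound on the number of
  edges.\<close>

lemma two_card_edges_conbrs:
  assumes "simple_graph G"
  shows "2 * card (edges G) + (\<Sum>v\<in>verts G. card (conbrs G v))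
    = card (verts G) * (card (verts G) - 1)"
proof -
  have "2 * card (edges G) + (\<Sum>v\<in>verts G. card (conbrs G v))
      = (\<Sum>v\<in>verts G. card (nbrs G v) + card (conbrs G v))"
    by (simp add: sum.distrib sum_card_nbrs assms)
  also have "\<dots> = (\<Sum>v\<in>verts G. card (verts G) - 1)"
    by (intro sum.cong refl card_nbrs_conbrs assms)
  finally show ?thesis by simp
qed

section \<open>Book-freeness in terms of complement neighbourhoods\<close>

text \<open>The edge \<open>{u, v}\<close> is the common edge of the triangles, and any
  \<open>p\<close> common neighbours of its ends supply the third vertices.\<close>

lemma contains_book_iff:
  assumes "simple_graph G"
  shows "contains_subgraph G (book p) \<longleftrightarrow>
    (\<exists>u v. {u, v} \<in> edges G \<and> p \<le> card (nbrs G u \<inter> nbrs G v))"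
proof
  assume "contains_subgraph G (book p)"
  then obtain f where inj: "inj_on f {..<p + 2}" and im: "f ` {..<p + 2} \<subseteq> verts G"
    and ed: "\<forall>e\<in>edges (book p). f ` e \<in> edges G"
    unfolding contains_subgraph_def book_def by auto
  have "{f 0, f 1} \<in> edges G" using ed by (auto simp: book_def)
  moreover have "f ` {2..<p + 2} \<subseteq> nbrs G (f 0) \<inter> nbrs G (f 1)"
    using ed im by (auto simp: book_def nbrs_def insert_commute)
  then have "card (f ` {2..<p + 2}) \<le> card (nbrs G (f 0) \<inter> nbrs G (f 1))"
    by (rule card_mono[rotated]) (simp add: finite_nbrs assms)
  moreover have "card (f ` {2..<p + 2}) = p"
    using card_image[OF inj_on_subset[OF inj, of "{2..<p + 2}"]] by (simp add: subset_iff)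
  ultimately show "\<exists>u v. {u, v} \<in> edges G \<and> p \<le> card (nbrs G u \<inter> nbrs G v)" by metis
next
  assume "\<exists>u v. {u, v} \<in> edges G \<and> p \<le> card (nbrs G u \<inter> nbrs G v)"
  then obtain u v where uv: "{u, v} \<in> edges G" and "p \<le> card (nbrs G u \<inter> nbrs G v)" by auto
  then obtain T where T: "T \<subseteq> nbrs G u \<inter> nbrs G v" "card T = p" "finite T"
    by (meson obtain_subset_with_card_n)
  then obtain h where h: "bij_betw h {2..<p + 2} T"
    using finite_same_card_bij[of "{2..<p + 2}" T] by auto
  have hT: "h i \<in> T" if "2 \<le> i" "i < p + 2" for i
    using bij_betwE[OF h] that by auto
  have uvT: "u \<notin> T" "v \<notin> T"
    using T simple_graph_no_loop[OF assms] by (auto simp: nbrs_def)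
  define f where "f i = (if i = 0 then u else if i = 1 then v else h i)" for i :: nat
  have "inj_on f {..<p + 2}"
  proof (rule inj_onI)
    fix i j assume ij: "i \<in> {..<p + 2}" "j \<in> {..<p + 2}" "f i = f j"
    have "inj_on h {2..<p + 2}" using h by (simp add: bij_betw_def)
    then show "i = j"
      using ij hT[of i] hT[of j] uvT simple_graph_edge_verts(3)[OF assms uv]
      by (auto simp: f_def inj_on_def split: if_splits)
  qed
  moreover have "f ` {..<p + 2} \<subseteq> verts G"
  proof (rule image_subsetI)
    fix i assume i: "i \<in> {..<p + 2}"
    have "i = 0 \<or> i = 1 \<or> 2 \<le> i" by linarith
    with i have "i = 0 \<or> i = 1 \<or> h i \<in> T" using hT[of i] by blast
    moreover have "T \<subseteq> verts G" using T by (auto simp: nbrs_def)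
    ultimately show "f i \<in> verts G"
      using simple_graph_edge_verts[OF assms uv] by (auto simp: f_def)
  qed
  moreover have "f ` e \<in> edges G" if e: "e \<in> edges (book p)" for e
  proof -
    consider "e = {0, 1}" | i where "2 \<le> i" "i < p + 2" "e = {0, i} \<or> e = {1, i}"
      using e by (auto simp: book_def)
    then show ?thesis
    proof cases
      case 1
      then show ?thesis using uv by (simp add: f_def insert_commute)
    next
      case 2
      then have "h i \<in> nbrs G u \<inter> nbrs G v" using hT T by blast
      then have "{u, h i} \<in> edges G" "{v, h i} \<in> edges G"
        by (auto simp: nbrs_def insert_commute)
      then show ?thesis using 2 by (auto simp: f_def insert_commute)
    qed
  qed
  moreover have "verts (book p) = {..<p + 2}" by (simp add: book_def)
  ultimately show "contains_subgraph G (book p)"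
    unfolding contains_subgraph_def by metis
qed

text \<open>A vertex other than \<open>u\<close> and \<open>v\<close> fails to be a common neighbour
  exactly when it is a complement neighbour of one of them; since \<open>u\<close> and
  \<open>v\<close> are adjacent, neither lies in the union on the left.\<close>

lemma card_common_nbrs:
  assumes "simple_graph G" "{u, v} \<in> edges G"
  shows "card (nbrs G u \<inter> nbrs G v) + card (conbrs G u \<union> conbrs G v) = card (verts G) - 2"
proof -
  have "nbrs G u \<inter> nbrs G v \<union> (conbrs G u \<union> conbrs G v) = verts G - {u, v}"
    using simple_graph_no_loop[OF assms(1)] assms(2)
    by (auto simp: nbrs_def conbrs_def insert_commute)
  moreover have "nbrs G u \<inter> nbrs G v \<inter> (conbrs G u \<union> conbrs G v) = {}"
    by (auto simp: nbrs_def conbrs_def)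
  moreover have "card (verts G - {u, v}) = card (verts G) - 2"
    using simple_graph_edge_verts[OF assms] by (subst card_Diff_subset) auto
  ultimately show ?thesis
    using card_Un_disjoint[of "nbrs G u \<inter> nbrs G v" "conbrs G u \<union> conbrs G v"] assms
    by (simp add: finite_nbrs finite_conbrs)
qed

text \<open>Besides the ends of an edge there are \<open>p + 4\<close> vertices, so fewer than
  \<open>p\<close> common neighbours means at least 5 vertices that are not.\<close>

lemma book_free_iff:
  assumes "simple_graph G" "card (verts G) = p + 6"
  shows "\<not> contains_subgraph G (book p) \<longleftrightarrow>
    (\<forall>u v. {u, v} \<in> edges G \<longrightarrow> 5 \<le> card (conbrs G u \<union> conbrs G v))"
proof -
  have "\<not> p \<le> card (nbrs G u \<inter> nbrs G v) \<longleftrightarrow> 5 \<le> card (conbrs G u \<union> conbrs G v)"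
    if "{u, v} \<in> edges G" for u v
    using card_common_nbrs[OF assms(1) that] assms(2) by linarith
  then show ?thesis unfolding contains_book_iff[OF assms(1)] by blast
qed

section \<open>The upper bound on the number of edges\<close>

lemma sum_card_conbrs_ge:
  assumes G: "simple_graph G" and n: "5 \<le> card (verts G)"
    and big: "\<And>u v. {u, v} \<in> edges G \<Longrightarrow> 5 \<le> card (conbrs G u \<union> conbrs G v)"
  shows "3 * card (verts G) \<le> (\<Sum>v\<in>verts G. card (conbrs G v)) + 3"
proof -
  let ?V = "verts G" and ?d = "\<lambda>v. card (conbrs G v)"
  have fV: "finite ?V" using G by (rule simple_graph_finite_verts)
  have far: "5 \<le> ?d u + ?d v" if "u \<in> ?V" "u \<noteq> v" "u \<notin> conbrs G v" for u v
    using big[of u v] that card_Un_le[of "conbrs G u" "conbrs G v"] by (auto simp: conbrs_def)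
  show ?thesis
  proof (cases "\<exists>v\<in>?V. ?d v \<le> 1")
    case True
    then obtain v where v: "v \<in> ?V" "?d v \<le> 1" by auto
    let ?W = "?V - insert v (conbrs G v)"
    have "card ?V \<le> card ?W + card (insert v (conbrs G v))"
      using diff_card_le_card_Diff[of "insert v (conbrs G v)" ?V] finite_conbrs[OF G, of v] by simp
    moreover have "card (insert v (conbrs G v)) \<le> 2"
      using v card_insert_le_m1[of 2 "conbrs G v" v] by simp
    ultimately have "4 * card ?V \<le> 4 * card ?W + 8" by linarith
    \<comment> \<open>Vertices of \<open>?W\<close> are nonadjacent to \<open>v\<close> in the
      complement, and \<open>?d v\<close> is at most 1, so \<open>far\<close> forces degree at least
      4. Summing gives at least \<open>4 * (card ?V - 2)\<close>, which suffices because
      \<open>card ?V\<close> is at least 5.\<close>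
    moreover have "4 * card ?W \<le> (\<Sum>u\<in>?W. ?d u)"
      using sum_bounded_below[of ?W 4 ?d] far[of _ v] v by force
    moreover have "(\<Sum>u\<in>?W. ?d u) \<le> (\<Sum>u\<in>?V. ?d u)"
      by (intro sum_mono2) (use fV in auto)
    ultimately show ?thesis using n by linarith
  next
    case False
    \<comment> \<open>All complement degrees are now at least 2, so \<open>L\<close> holds the
      vertices of degree exactly 2. Two of them have degree sum 4 and must be adjacent in the
      complement by \<open>far\<close>; hence \<open>L\<close> fits in a closed neighbourhood of
      size 3.\<close>
    define L where "L = {v \<in> ?V. ?d v \<le> 2}"
    have L: "L \<subseteq> ?V" "finite L" using fV by (auto simp: L_def)
    have "card L \<le> 3"
    proof (cases "L = {}")
      case False
      then obtain v where v: "v \<in> L" by auto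
      have "L - {v} \<subseteq> conbrs G v"
        using far[of _ v] v by (force simp: L_def)
      then have "card (L - {v}) \<le> card (conbrs G v)"
        by (rule card_mono[OF finite_conbrs[OF G]])
      then have "card (L - {v}) \<le> 2" using v by (simp add: L_def)
      then show ?thesis using v L by simp
    qed simp
    have "3 * card ?V = (\<Sum>v\<in>?V. 3)" by simp
    \<comment> \<open>Only the vertices of \<open>L\<close> fall short of degree 3, each by
      one.\<close>
    also have "\<dots> \<le> (\<Sum>v\<in>?V. ?d v + (if v \<in> L then 1 else 0))"
      by (intro sum_mono) (use False in \<open>auto simp: L_def not_le\<close>)
    also have "\<dots> = (\<Sum>v\<in>?V. ?d v) + card L"
      using L fV by (simp add: sum.distrib sum.If_cases Int_absorb1)
    finally show ?thesis using \<open>card L \<le> 3\<close> by linarith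
  qed
qed

lemma book_free_card_edges:
  assumes "simple_graph G" "card (verts G) = p + 6" "\<not> contains_subgraph G (book p)"
  shows "2 * card (edges G) \<le> (p + 3) * (p + 5)"
proof -
  have "3 * (p + 6) \<le> (\<Sum>v\<in>verts G. card (conbrs G v)) + 3"
    using sum_card_conbrs_ge[OF assms(1)] assms(3) book_free_iff[OF assms(1,2)] assms(2) by auto
  moreover have "2 * card (edges G) + (\<Sum>v\<in>verts G. card (conbrs G v)) = (p + 6) * (p + 5)"
    using two_card_edges_conbrs[OF assms(1)] assms(2) by simp
  ultimately show ?thesis by (simp add: algebra_simps)
qed

section \<open>Complements of book-free graphs and their disjoint unions\<close>

text \<open>
  \<open>N u\<close> plays the role of \<^term>\<open>conbrs G u\<close> for a book-free \<open>G\<close>. The minimum degree \<open>d\<close> is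
  recorded because a disjoint union needs \<open>d + d' \<ge> 5\<close> across its parts.
\<close>

definition nbhd_system :: "nat \<Rightarrow> nat \<Rightarrow> (nat \<Rightarrow> nat set) \<Rightarrow> bool" where
  "nbhd_system d n N \<longleftrightarrow>
     (\<forall>u\<in>{..<n}. N u \<subseteq> {..<n} \<and> u \<notin> N u \<and> d \<le> card (N u) \<and>
       (\<forall>v\<in>{..<n}. (v \<in> N u \<longleftrightarrow> u \<in> N v) \<and> (v = u \<or> v \<in> N u \<or> 5 \<le> card (N u \<union> N v))))"

definition realizable :: "nat \<Rightarrow> nat \<Rightarrow> nat \<Rightarrow> bool" where
  "realizable d n s \<longleftrightarrow> (\<exists>N. nbhd_system d n N \<and> (\<Sum>u<n. card (N u)) = s)"

text \<open>Vertices in different parts of a disjoint union have disjoint neighbourhoods, whose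
  union has at least \<open>d + d'\<close> elements; pairs within one part are unaffected.\<close>

lemma realizable_join:
  assumes "realizable d m s" "realizable d' n t" "d \<le> d'" "5 \<le> d + d'"
  shows "realizable d (m + n) (s + t)"
proof -
  obtain M where M: "nbhd_system d m M" "(\<Sum>u<m. card (M u)) = s"
    using assms(1) by (auto simp: realizable_def)
  obtain N where N: "nbhd_system d' n N" "(\<Sum>u<n. card (N u)) = t"
    using assms(2) by (auto simp: realizable_def)
  \<comment> \<open>The second part is shifted by \<open>m\<close> to occupy the vertices from
    \<open>m\<close> to \<open>m + n - 1\<close>.\<close>
  define K where "K u = (if u < m then M u else (+) m ` N (u - m))" for u
  have KM: "K u = M u" if "u < m" for u using that by (simp add: K_def)
  have KN: "K (m + u) = (+) m ` N u" for u by (simp add: K_def)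
  have Msub: "M u \<subseteq> {..<m}" "finite (M u)" if "u < m" for u
    using M(1) that finite_subset[of "M u" "{..<m}"] by (auto simp: nbhd_system_def)
  have Nsub: "N u \<subseteq> {..<n}" "finite (N u)" if "u < n" for u
    using N(1) that finite_subset[of "N u" "{..<n}"] by (auto simp: nbhd_system_def)
  have cardN: "card (K (m + u)) = card (N u)" for u
    by (simp add: KN card_image)
  have cross: "5 \<le> card (K u \<union> K (m + v))" if "u < m" "v < n" for u v
  proof -
    have "K u \<inter> K (m + v) = {}" using Msub(1)[OF that(1)] by (auto simp: KM KN that)
    then have "card (K u \<union> K (m + v)) = card (M u) + card (N v)"
      using Msub[OF that(1)] Nsub[OF that(2)] cardN[of v]
      by (subst card_Un_disjoint) (auto simp: KM KN that)
    moreover have "d \<le> card (M u)" "d' \<le> card (N v)"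
      using M N that by (auto simp: nbhd_system_def)
    ultimately show ?thesis using assms(4) by linarith
  qed
  have split: "\<exists>i<n. u = m + i" if "u < m + n" "\<not> u < m" for u
    using that by (intro exI[of _ "u - m"]) auto
  have pair: "(v \<in> K u \<longleftrightarrow> u \<in> K v) \<and> (v = u \<or> v \<in> K u \<or> 5 \<le> card (K u \<union> K v))"
    if uv: "u < m + n" "v < m + n" for u v
  proof (cases "u < m"; cases "v < m")
    assume "u < m" "v < m"
    then show ?thesis using M(1) by (auto simp: KM nbhd_system_def)
  next
    assume a: "u < m" "\<not> v < m"
    then obtain j where "j < n" "v = m + j" using split uv by blast
    then show ?thesis using a cross[of u j] Msub(1)[OF a(1)] by (auto simp: KM KN)
  next
    assume a: "\<not> u < m" "v < m"
    then obtain j where "j < n" "u = m + j" using split uv by blast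
    then show ?thesis using a cross[of v j] Msub(1)[OF a(2)] by (auto simp: KM KN Un_commute)
  next
    assume "\<not> u < m" "\<not> v < m"
    then obtain i j where ij: "i < n" "u = m + i" "j < n" "v = m + j" using split uv by metis
    then have "card (K u \<union> K v) = card (N i \<union> N j)"
      by (simp add: KN card_image flip: image_Un)
    then show ?thesis using N(1) ij by (auto simp: KN nbhd_system_def)
  qed
  have single: "K u \<subseteq> {..<m + n} \<and> u \<notin> K u \<and> d \<le> card (K u)" if u: "u < m + n" for u
  proof (cases "u < m")
    case True
    then have "M u \<subseteq> {..<m}" "u \<notin> M u" "d \<le> card (M u)"
      using M(1) by (auto simp: nbhd_system_def)
    moreover have "{..<m} \<subseteq> {..<m + n}" by auto
    ultimately show ?thesis using True by (simp add: KM subset_trans)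
  next
    case False
    then obtain i where i: "i < n" "u = m + i" using split u by blast
    then have "d' \<le> card (N i)" "N i \<subseteq> {..<n}" "i \<notin> N i"
      using N(1) by (auto simp: nbhd_system_def)
    then have "K u \<subseteq> {..<m + n}" "u \<notin> K u" "d' \<le> card (K u)"
      using i cardN[of i] by (auto simp: KN)
    then show ?thesis using assms(3) by simp
  qed
  have "nbhd_system d (m + n) K"
    unfolding nbhd_system_def using single pair by (meson lessThan_iff)
  moreover have "(\<Sum>u<m + n. card (K u)) = s + t"
  proof -
    have "(\<Sum>u<m + n. card (K u)) = (\<Sum>u<m. card (K u)) + (\<Sum>u<n. card (K (m + u)))"
      using sum.atLeastLessThan_concat[of 0 m "m + n" "\<lambda>u. card (K u)"]
        sum.shift_bounds_nat_ivl[of "\<lambda>u. card (K u)" 0 m n]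
      by (simp add: lessThan_atLeast0 add.commute)
    then show ?thesis using M(2) N(2) by (simp add: KM cardN)
  qed
  ultimately show ?thesis by (auto simp: realizable_def)
qed

text \<open>Adjacency lists with lengths in place of cardinalities turn the conditions for a
  concrete graph into a finite computation for the simplifier.\<close>

lemma realizable_lists:
  assumes "\<forall>u\<in>set [0..<n]. (\<forall>v\<in>set (xs ! u). v < n) \<and> u \<notin> set (xs ! u) \<and>
      distinct (xs ! u) \<and> d \<le> length (xs ! u) \<and>
      (\<forall>v\<in>set [0..<n]. (v \<in> set (xs ! u) \<longleftrightarrow> u \<in> set (xs ! v)) \<and>
        (v = u \<or> v \<in> set (xs ! u) \<or> 5 \<le> length (remdups (xs ! u @ xs ! v))))"
    and "sum_list (map (\<lambda>u. length (xs ! u)) [0..<n]) = s"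
  shows "realizable d n s"
proof -
  have U: "card (set (xs ! u) \<union> set (xs ! v)) = length (remdups (xs ! u @ xs ! v))" for u v
    by (simp only: length_remdups_card_conv set_append)
  have n: "set [0..<n] = {..<n}" by auto
  have deg: "card (set (xs ! u)) = length (xs ! u)" if "u < n" for u
    using assms(1) that by (intro distinct_card) (simp only: n lessThan_iff Ball_def)
  have "nbhd_system d n (\<lambda>u. set (xs ! u))"
    unfolding nbhd_system_def
  proof (rule ballI)
    fix u assume u: "u \<in> {..<n}"
    note a = bspec[OF assms(1)[unfolded n] u]
    have "set (xs ! u) \<subseteq> {..<n}" using a by blast
    moreover have "d \<le> card (set (xs ! u))" using a u by (simp add: deg)
    ultimately show "set (xs ! u) \<subseteq> {..<n} \<and> u \<notin> set (xs ! u) \<and> d \<le> card (set (xs ! u)) \<and>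
        (\<forall>v\<in>{..<n}. (v \<in> set (xs ! u) \<longleftrightarrow> u \<in> set (xs ! v)) \<and>
          (v = u \<or> v \<in> set (xs ! u) \<or> 5 \<le> card (set (xs ! u) \<union> set (xs ! v))))"
      using a unfolding U by (intro conjI) (elim conjE, assumption)+
  qed
  moreover have "(\<Sum>u<n. card (set (xs ! u))) = s"
    using assms(2) by (simp add: deg sum_set_upt_conv_sum_list_nat[symmetric] lessThan_atLeast0)
  ultimately show ?thesis unfolding realizable_def by blast
qed

section \<open>The building blocks\<close>

lemma realizable_K3: "realizable 2 3 6"
  by (rule realizable_lists[where xs = "[[1,2],[0,2],[0,1]]"]; simp add: upt_rec_numeral upt_rec)

lemma realizable_K4: "realizable 3 4 12"
  by (rule realizable_lists[where xs = "[[1,2,3],[0,2,3],[0,1,3],[0,1,2]]"]; simp add: upt_rec_numeral upt_rec)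

text \<open>This is the Moser spindle: two copies of \<open>K\<^sub>4\<close> minus an edge share
  the vertex 0, and their opposite tips 5 and 6 are joined. Every nonadjacent pair has exactly 5
  neighbours in total.\<close>

lemma realizable_seven: "realizable 3 7 22"
  by (rule realizable_lists[where
        xs = "[[1,2,3,4],[0,2,5],[0,1,5],[0,4,6],[0,3,6],[1,2,6],[3,4,5]]"]; simp add: upt_rec_numeral upt_rec)

text \<open>Nonadjacent vertices of the Petersen graph have exactly one common neighbour, so their
  neighbourhoods cover 3 + 3 - 1 = 5 vertices.\<close>

lemma realizable_petersen: "realizable 3 10 30"
  by (rule realizable_lists[where
        xs = "[[1,4,5],[0,2,6],[1,3,7],[2,4,8],[3,0,9],[0,7,8],[1,8,9],[2,9,5],[3,5,6],[4,6,7]]"];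
      simp add: upt_rec_numeral upt_rec)

text \<open>Adding a \<open>K\<^sub>4\<close> keeps the difference between the degree sum and
  \<open>3 * n\<close>, so only the residue of \<open>n\<close> modulo 4 matters once a starting
  graph exists. The minimum degrees 2 and 3 just meet the threshold 5.\<close>

lemma realizable_add_K4s: "realizable 2 n s \<Longrightarrow> realizable 2 (n + 4 * k) (s + 12 * k)"
proof (induction k)
  case (Suc k)
  have "realizable 2 (n + 4 * k + 4) (s + 12 * k + 12)"
    by (rule realizable_join[OF Suc.IH[OF Suc.prems] realizable_K4]) simp_all
  then show ?case by (simp add: add_ac)
qed simp

lemma realizable_odd:
  assumes "odd n" "11 \<le> n"
  shows "realizable 2 n (3 * n - 3)"
proof (cases "n mod 4 = 3")
  case True
  then have "n = 3 + 4 * (n div 4)" by presburger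
  then obtain k where "n = 3 + 4 * k" by blast
  then show ?thesis using realizable_add_K4s[OF realizable_K3, of k] by (simp add: algebra_simps)
next
  case False
  \<comment> \<open>Here \<open>n\<close> is 1 modulo 4, and 13 = 3 + 10 is the order of a triangle
    together with a Petersen graph.\<close>
  then have "n = 13 + 4 * ((n - 13) div 4)" using assms by presburger
  then obtain k where "n = 13 + 4 * k" by blast
  moreover have "realizable 2 13 36"
    using realizable_join[OF realizable_K3 realizable_petersen] by simp
  ultimately show ?thesis
    using realizable_add_K4s[of 13 36 k] by (simp add: algebra_simps)
qed

lemma realizable_even:
  assumes "even n" "10 \<le> n" "n \<notin> {12, 16}"
  shows "realizable 2 n (3 * n - 2)"
proof -
  have ten: "realizable 2 10 28"
    using realizable_join[OF realizable_K3 realizable_seven] by simp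
  show ?thesis
  proof (cases "n mod 4 = 2")
    case True
    then have "n = 10 + 4 * ((n - 10) div 4)" using assms by presburger
    then obtain k where "n = 10 + 4 * k" by blast
    then show ?thesis using realizable_add_K4s[OF ten, of k] by (simp add: algebra_simps)
  next
    case False
    moreover have "n \<noteq> 12" "n \<noteq> 16" using assms(3) by simp_all
    \<comment> \<open>A multiple of 4 that is at least 10 and neither 12 nor 16 is at least 20, the
      order of triangle, spindle and Petersen graph together.\<close>
    ultimately have "n = 20 + 4 * ((n - 20) div 4)" using assms(1,2) by presburger
    then obtain k where "n = 20 + 4 * k" by blast
    moreover have "realizable 2 20 58"
      using realizable_join[OF ten realizable_petersen] by simp
    ultimately show ?thesis
      using realizable_add_K4s[of 20 58 k] by (simp add: algebra_simps)
  qed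
qed

section \<open>The extremal numbers\<close>

lemma realizable_book_free:
  assumes "realizable d (p + 6) s"
  obtains G :: "nat sgraph" where "simple_graph G" "card (verts G) = p + 6"
    "\<not> contains_subgraph G (book p)" "2 * card (edges G) + s = (p + 6) * (p + 5)"
proof -
  define n where "n = p + 6"
  obtain N where N: "nbhd_system d n N" "(\<Sum>u<n. card (N u)) = s"
    using assms by (auto simp: realizable_def n_def)
  define G :: "nat sgraph" where
    "G = ({..<n}, {{u, v} | u v. u < n \<and> v < n \<and> u \<noteq> v \<and> v \<notin> N u})"
  have G: "simple_graph G" by (auto simp: simple_graph_def G_def)
  have V: "verts G = {..<n}" by (simp add: G_def)
  \<comment> \<open>An edge of \<open>G\<close> may list its ends in either order; the symmetry of
    \<open>N\<close> makes the condition independent of that order.\<close>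
  have E: "{u, v} \<in> edges G \<longleftrightarrow> u < n \<and> v < n \<and> u \<noteq> v \<and> v \<notin> N u" for u v
    using N(1) by (auto simp: G_def nbhd_system_def doubleton_eq_iff)
  have C: "conbrs G v = N v" if "v < n" for v
    using N(1) that by (auto simp: conbrs_def V E nbhd_system_def)
  have "\<forall>u v. {u, v} \<in> edges G \<longrightarrow> 5 \<le> card (conbrs G u \<union> conbrs G v)"
    using N(1) by (auto simp: E C nbhd_system_def)
  then have "\<not> contains_subgraph G (book p)"
    using book_free_iff[OF G] V by (simp add: n_def)
  moreover have "2 * card (edges G) + s = (p + 6) * (p + 5)"
    using two_card_edges_conbrs[OF G] N(2) by (simp add: V C n_def)
  ultimately show ?thesis using that[OF G] V by (simp add: n_def)
qed

text \<open>The slack of 1 in the last hypothesis covers even \<open>p\<close>, where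
  \<open>(p + 3) * (p + 5)\<close> is odd and cannot equal twice a number of edges.\<close>

lemma ex_book_eqI:
  assumes "realizable d (p + 6) s" "2 * m + s = (p + 6) * (p + 5)"
    and "(p + 3) * (p + 5) \<le> 2 * m + 1"
  shows "ex (p + 6) (book p) = m"
proof -
  let ?S = "{card (edges G) | G :: nat sgraph.
     simple_graph G \<and> card (verts G) = p + 6 \<and> \<not> contains_subgraph G (book p)}"
  have le: "k \<le> m" if "k \<in> ?S" for k
  proof -
    have "2 * k \<le> (p + 3) * (p + 5)" using that book_free_card_edges by auto
    then show ?thesis using assms(3) by linarith
  qed
  moreover have "finite ?S"
    using le by (intro finite_subset[of ?S "{..m}"]) auto
  moreover have "m \<in> ?S"
  proof -
    obtain G :: "nat sgraph" where "simple_graph G" "card (verts G) = p + 6"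
      "\<not> contains_subgraph G (book p)" "2 * card (edges G) + s = (p + 6) * (p + 5)"
      using realizable_book_free[OF assms(1)] .
    moreover from this have "card (edges G) = m" using assms(2) by linarith
    ultimately show ?thesis by blast
  qed
  ultimately show ?thesis unfolding ex_def by (intro Max_eqI)
qed

theorem theorem13:
  fixes p :: nat
  assumes "p > 0"
  shows "(odd p \<and> p \<ge> 5 \<longrightarrow> real (ex (p + 6) (book p)) = (real p + 3) * (real p + 5) / 2) \<and>
         (even p \<and> p \<notin> {2, 6, 10} \<longrightarrow>
            real (ex (p + 6) (book p)) = 1 + (real p + 2) * (real p + 6) / 2)"
proof (intro conjI impI)
  assume p: "odd p \<and> p \<ge> 5"
  then obtain q where q: "p = 2 * q + 1" by (auto elim: oddE)
  have "realizable 2 (p + 6) (3 * (p + 6) - 3)" using p by (intro realizable_odd) auto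
  \<comment> \<open>With \<open>p = 2 * q + 1\<close>, this is \<open>(p + 3) * (p + 5) / 2\<close>
    written without division.\<close>
  then have "ex (p + 6) (book p) = 2 * (q + 2) * (q + 3)"
    by (rule ex_book_eqI) (simp_all add: q algebra_simps)
  then show "real (ex (p + 6) (book p)) = (real p + 3) * (real p + 5) / 2"
    by (simp add: q algebra_simps)
next
  assume p: "even p \<and> p \<notin> {2, 6, 10}"
  then obtain q where q: "p = 2 * q" by auto
  \<comment> \<open>These exclusions leave \<open>p\<close> at least 4, hence \<open>p + 6\<close>
    at least 10; the excluded values 6 and 10 of \<open>p\<close> correspond to the orders 12 and
    16.\<close>
  have "p \<noteq> 0" "p \<noteq> 1" "p \<noteq> 2" "p \<noteq> 3" using p assms by auto
  then have "realizable 2 (p + 6) (3 * (p + 6) - 2)" using p by (intro realizable_even) auto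
  then have "ex (p + 6) (book p) = 1 + 2 * (q + 1) * (q + 3)"
    by (rule ex_book_eqI) (simp_all add: q algebra_simps)
  then show "real (ex (p + 6) (book p)) = 1 + (real p + 2) * (real p + 6) / 2"
    by (simp add: q algebra_simps)
qed

end
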